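(* Let $(m_1,m_2,m_3,t_1,t_2)\in \mathbb{N}^5$ be a solution to the Diophantine equation $$F_{m_1} + F_{m_2} + F_{m_3} = 2^{t_1} + 2^{t_2}$$ such that $m_1 \geq m_2 \geq m_3 \geq 0$ and $t_1 \geq t_2 \geq 0$. Then $m_1 \leq 16$ and $t_1 \leq 10$. In particular, this equation has exactly $116$ solutions (with $m_1 \geq m_2 \geq m_3 \geq 0$ and $t_1 \geq t_2 \geq 0$).
   Context: $F_k$ denotes the $k$-th Fibonacci number: $F_0=0$, $F_1=1$, $F_{k+2}=F_{k+1}+F_k$ for $k\geq 0$. Here $\mathbb{N}$ includes $0$. *)

theory Defs
  imports "HOL-Number_Theory.Fib"
begin

end

theory Submission
  imports Defs
begin

text \<open>
  Suppose that one of the two exponents of a solution is at least 13. The three indices are known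
  modulo \<open>N\<close> and the two exponents modulo \<open>P\<close>, where at first \<open>N = P = 1\<close>. If the Fibonacci numbers
  modulo \<open>M\<close> have a period dividing \<open>N * r\<close>, and the powers of 2 one dividing \<open>P * q\<close>, then the equation
  modulo \<open>M\<close> rules out most of the classes modulo \<open>N * r\<close> and \<open>P * q\<close> above a given one. The moduli
  \<open>M = 2 ^ e\<close> with \<open>e \<le> 13\<close> are special: there one of the powers on the right-hand side vanishes. A few dozen
  moduli suffice to eliminate all classes; the final values are \<open>N = 921600\<close> and \<open>P = 1612800\<close>.

  The bound 13 cannot be lowered in this argument. Congruences do not see the sign of an
  index, and with \<open>fib (- n) = (- 1) ^ (n + 1) * fib n\<close> there are further solutions such as
  \<open>fib 18 + fib (- 4) + fib (- 8) = 2 ^ 11 + 2 ^ 9\<close> and \<open>fib 19 + fib 0 + fib (- 8) = 2 ^ 12 + 2 ^ 6\<close>.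
  The solutions with exponents up to 12 have indices up to 20 and are enumerated.
\<close>

section \<open>Fibonacci numbers and powers of 2 modulo M\<close>

datatype kind = Fibonacci | Power

fun exact :: "kind \<Rightarrow> nat \<Rightarrow> int \<times> int" where
  "exact Fibonacci n = (int (fib n), int (fib (Suc n)))"
| "exact Power n = (0, 2 ^ n)"

text \<open>With this sign a solution of the equation is a vanishing sum of five weights.\<close>

fun weight :: "kind \<Rightarrow> nat \<Rightarrow> int" where
  "weight Fibonacci n = int (fib n)"
| "weight Power n = - (2 ^ n)"

fun reduce :: "int \<Rightarrow> int \<times> int \<Rightarrow> int \<times> int" where
  "reduce M (x, y) = (x mod M, y mod M)"

definition residue :: "kind \<Rightarrow> int \<Rightarrow> nat \<Rightarrow> int \<times> int" where
  "residue k M n = reduce M (exact k n)"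

text \<open>
  The pair \<open>(x, y)\<close> stands for \<open>(y - x) + x * \<phi>\<close> in the ring generated by \<open>\<phi>\<close> with \<open>\<phi>\<^sup>2 = \<phi> + 1\<close>,
  so \<^term>\<open>exact Fibonacci n\<close> is \<open>\<phi> ^ n\<close> and \<^term>\<open>exact Power n\<close> is \<open>2 ^ n\<close>.
\<close>

fun pair_mul :: "int \<Rightarrow> int \<times> int \<Rightarrow> int \<times> int \<Rightarrow> int \<times> int" where
  "pair_mul M (x, x') (y, y') = ((x * y' + (x' - x) * y) mod M, (x' * y' + x * y) mod M)"

lemma reduce_idem [simp]: "reduce M (reduce M p) = reduce M p"
  by (cases p) simp

lemma reduce_residue [simp]: "reduce M (residue k M n) = residue k M n"
  by (simp add: residue_def)

lemma pair_mul_reduce: "pair_mul M (reduce M p) (reduce M q) = pair_mul M p q"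
proof (cases p, cases q)
  fix x x' y y' assume p: "p = (x, x')" and q: "q = (y, y')"
  have "(x mod M * (y' mod M) + (x' mod M - x mod M) * (y mod M)) mod M = (x * y' + (x' - x) * y) mod M"
    by (intro mod_add_cong mod_mult_cong mod_diff_cong) simp_all
  moreover have "(x' mod M * (y' mod M) + x mod M * (y mod M)) mod M = (x' * y' + x * y) mod M"
    by (intro mod_add_cong mod_mult_cong) simp_all
  ultimately show ?thesis by (simp add: p q)
qed

text \<open>In the ring this is \<open>\<phi> ^ i * \<phi> ^ j = \<phi> ^ (i + j)\<close>; in
  coordinates it is the addition formula for Fibonacci numbers.\<close>

lemma pair_mul_exact: "pair_mul M (exact k i) (exact k j) = residue k M (i + j)"
proof (cases k)
  case Fibonacci
  have 1: "int (fib (i + j)) = int (fib i) * int (fib (Suc j)) + (int (fib (Suc i)) - int (fib i)) * int (fib j)"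
  \<comment> \<open>\<open>fib_add\<close> speaks of \<open>fib (Suc (n + k))\<close>, so a nonzero
    \<open>i\<close> is written as a successor.\<close>
  proof (cases i)
    case (Suc i')
    then show ?thesis using fib_add[of i' j] by (simp add: algebra_simps)
  qed simp
  have 2: "int (fib (Suc (i + j))) = int (fib (Suc i)) * int (fib (Suc j)) + int (fib i) * int (fib j)"
    by (simp add: fib_add[of i j] algebra_simps)
  show ?thesis
    unfolding Fibonacci residue_def by (simp only: exact.simps pair_mul.simps reduce.simps 1 2)
qed (simp add: residue_def power_add)

lemma pair_mul_residue:
  assumes "reduce M p = residue k M i" "reduce M q = residue k M j"
  shows "pair_mul M p q = residue k M (i + j)"
proof -
  have "pair_mul M p q = pair_mul M (reduce M (exact k i)) (reduce M (exact k j))"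
    using assms by (metis pair_mul_reduce residue_def)
  then show ?thesis by (simp add: pair_mul_reduce pair_mul_exact)
qed

section \<open>Fast exponentiation modulo M\<close>

fun base :: "kind \<Rightarrow> int \<times> int" where
  "base Fibonacci = (1, 1)"
| "base Power = (0, 2)"

lemma base_eq: "base k = exact k 1"
  by (cases k) simp_all

fun power_acc :: "int \<Rightarrow> int \<times> int \<Rightarrow> int \<times> int \<Rightarrow> num \<Rightarrow> int \<times> int" where
  "power_acc M x y num.One = pair_mul M x y"
| "power_acc M x y (num.Bit0 n) = power_acc M x (pair_mul M y y) n"
| "power_acc M x y (num.Bit1 n) = power_acc M (pair_mul M x y) (pair_mul M y y) n"

lemma power_acc_residue:
  assumes "reduce M x = residue k M i" "reduce M y = residue k M j"
  shows "power_acc M x y n = residue k M (i + j * nat_of_num n)"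
  using assms
proof (induction M x y n arbitrary: i j rule: power_acc.induct)
  case (2 M x y n)
  have "reduce M (pair_mul M y y) = residue k M (j + j)"
    using 2(3) by (simp add: pair_mul_residue)
  from 2(1)[OF 2(2) this] show ?case by (simp add: algebra_simps)
next
  case (3 M x y n)
  have "reduce M (pair_mul M y y) = residue k M (j + j)"
    using 3(3) by (simp add: pair_mul_residue)
  moreover have "reduce M (pair_mul M x y) = residue k M (i + j)"
    using 3(2,3) by (simp add: pair_mul_residue)
  ultimately show ?case using 3(1)[of "i + j" "j + j"] by (simp add: algebra_simps)
qed (simp add: pair_mul_residue)

definition pair_at :: "kind \<Rightarrow> int \<Rightarrow> int \<Rightarrow> int \<times> int" where
  "pair_at k M i = residue k M (nat i)"

lemma residue_0: "residue k M 0 = (0, 1 mod M)"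
  by (cases k) (simp_all add: residue_def)

text \<open>Evaluation uses repeated squaring modulo \<open>M\<close> instead of the huge exact
  values. Negative arguments become 0 under \<open>nat\<close>.\<close>

lemma pair_at_code [code]:
  "pair_at k M 0 = (0, 1 mod M)"
  "pair_at k M (Int.Pos n) = power_acc M (0, 1 mod M) (base k) n"
  "pair_at k M (Int.Neg n) = (0, 1 mod M)"
proof -
  have "power_acc M (0, 1 mod M) (base k) n = residue k M (0 + 1 * nat_of_num n)"
    by (rule power_acc_residue) (simp_all add: residue_0[of k, symmetric] base_eq residue_def)
  then show "pair_at k M (Int.Pos n) = power_acc M (0, 1 mod M) (base k) n"
    by (simp add: pair_at_def nat_of_num_numeral)
qed (simp_all add: pair_at_def residue_0)

text \<open>A sum of two reduced residues needs one conditional subtraction, not a division.\<close>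

fun cut :: "int \<Rightarrow> int \<Rightarrow> int" where
  "cut M x = (if x < M then x else x - M)"

fun succ_pair :: "kind \<Rightarrow> int \<Rightarrow> int \<times> int \<Rightarrow> int \<times> int" where
  "succ_pair Fibonacci M (x, y) = (y, cut M (x + y))"
| "succ_pair Power M (x, y) = (x, cut M (y + y))"

fun val :: "kind \<Rightarrow> int \<Rightarrow> int \<times> int \<Rightarrow> int" where
  "val Fibonacci M (x, y) = x"
| "val Power M (x, y) = (if y = 0 then 0 else M - y)"

lemma cut_eq:
  assumes "M > 0" "x \<ge> 0" "x < M + M"
  shows "cut M x = x mod M"
proof (cases "x < M")
  case False
  then have "x mod M = (x - M) mod M" by simp
  also have "\<dots> = x - M" using assms False by (intro mod_pos_pos_trivial) auto
  finally show ?thesis using False by simp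
qed (use assms in \<open>simp add: mod_pos_pos_trivial\<close>)

lemma cut_add: "M > 0 \<Longrightarrow> cut M (x mod M + y mod M) = (x + y) mod M"
  using pos_mod_bound[of M x] pos_mod_bound[of M y] pos_mod_sign[of M x] pos_mod_sign[of M y]
  by (subst cut_eq) (auto simp: mod_add_eq simp del: pos_mod_bound pos_mod_sign cut.simps)

lemma succ_pair_residue: "M > 0 \<Longrightarrow> succ_pair k M (residue k M n) = residue k M (Suc n)"
  using cut_add[of M "2 ^ n" "2 ^ n"]
  by (cases k) (simp_all add: residue_def cut_add add.commute del: cut.simps)

lemma val_residue: "M > 0 \<Longrightarrow> val k M (residue k M n) = weight k n mod M"
  by (cases k) (simp_all add: residue_def zmod_zminus1_eq_if)

text \<open>One check suffices: the hypothesis says that the generator to the power \<open>P\<close>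
  is 1, so shifting by \<open>P\<close> is multiplication by 1.\<close>

lemma weight_periodic:
  assumes "M > 0" and "residue k M P = residue k M 0"
  shows "weight k (n mod P) mod M = weight k n mod M"
proof -
  have "residue k M (i + P * q) = residue k M i" for i q
  proof (induction q)
    case (Suc q)
    have "residue k M (i + P * Suc q) = residue k M (P + (i + P * q))" by (simp add: algebra_simps)
    also have "\<dots> = pair_mul M (residue k M P) (residue k M (i + P * q))"
      by (rule pair_mul_residue[symmetric]) simp_all
    also have "\<dots> = pair_mul M (residue k M 0) (residue k M i)" by (simp add: Suc assms)
    also have "\<dots> = residue k M (0 + i)" by (rule pair_mul_residue) simp_all
    finally show ?case by simp
  qed simp
  from this[of "n mod P" "n div P"] have "residue k M n = residue k M (n mod P)" by simp
  then show ?thesis using val_residue[OF assms(1), of k] by metis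
qed

text \<open>The pair \<open>(0, -1)\<close> stands for -1, so a shift by \<open>q\<close> is
  multiplication by -1.\<close>

lemma weight_antiperiodic:
  assumes "residue k M q = reduce M (0, -1)"
  shows "weight k (n + q) mod M = (- weight k n) mod M"
proof -
  have "residue k M (n + q) = pair_mul M (exact k n) (0, -1)"
    by (rule pair_mul_residue[symmetric]) (simp add: residue_def, simp only: assms)
  then show ?thesis by (cases k) (auto simp: residue_def dest: mod_minus_cong)
qed

section \<open>Tables of residues\<close>

type_synonym entry = "(int \<times> int) list"
type_synonym seeds = "(int \<times> int \<times> int) list"

fun row :: "kind \<Rightarrow> int \<Rightarrow> (int \<times> int) list \<Rightarrow> int list" where
  "row k M [] = []"
| "row k M (p # ps) = val k M p # row k M ps"

fun advance :: "kind \<Rightarrow> int \<Rightarrow> (int \<times> int) list \<Rightarrow> (int \<times> int) list" where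
  "advance k M [] = []"
| "advance k M (p # ps) = succ_pair k M p # advance k M ps"

fun pairs_at :: "kind \<Rightarrow> int \<Rightarrow> int list \<Rightarrow> (int \<times> int) list" where
  "pairs_at k M [] = []"
| "pairs_at k M (h # hs) = pair_at k M h # pairs_at k M hs"

text \<open>All lifts \<open>h + a\<close> of a residue \<open>a\<close> advance in parallel; this
  and \<open>row_at\<close> specify the state reached at \<open>a\<close>.\<close>

definition seeds_at :: "kind \<Rightarrow> int \<Rightarrow> int list \<Rightarrow> nat \<Rightarrow> (int \<times> int) list" where
  "seeds_at k M hs a = map (\<lambda>h. residue k M (nat h + a)) hs"

definition row_at :: "kind \<Rightarrow> int \<Rightarrow> int list \<Rightarrow> nat \<Rightarrow> int list" where
  "row_at k M hs a = map (\<lambda>h. weight k (nat h + a) mod M) hs"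

lemma pairs_at_eq: "pairs_at k M hs = seeds_at k M hs 0"
  by (induction hs) (simp_all add: seeds_at_def pair_at_def)

lemma advance_seeds: "M > 0 \<Longrightarrow> advance k M (seeds_at k M hs a) = seeds_at k M hs (Suc a)"
  by (induction hs) (simp_all add: seeds_at_def succ_pair_residue)

lemma row_seeds: "M > 0 \<Longrightarrow> row k M (seeds_at k M hs a) = row_at k M hs a"
  by (induction hs) (simp_all add: seeds_at_def row_at_def val_residue)

section \<open>Binary tries with logarithmic access\<close>

datatype trie = Tip | Cell "int list" | Branch trie trie

fun look :: "trie \<Rightarrow> bool list \<Rightarrow> int list" where
  "look (Branch l r) (True # bs) = look r bs"
| "look (Branch l r) (False # bs) = look l bs"
| "look (Cell x) bs = x"
| "look t bs = []"

fun bits :: "num \<Rightarrow> bool list \<Rightarrow> bool list" where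
  "bits num.One bs = bs"
| "bits (num.Bit0 n) bs = bits n (False # bs)"
| "bits (num.Bit1 n) bs = bits n (True # bs)"

text \<open>A position \<open>j < 2 ^ d\<close> is passed as \<open>j + 2 ^ d\<close>. Dropping the
  leading 1 leaves exactly \<open>d\<close> digits, leading zeros included.\<close>

definition index_bits :: "int \<Rightarrow> bool list" where
  "index_bits i = (if i > 0 then bits (num_of_nat (nat i)) [] else [])"

lemma index_bits_code [code]:
  "index_bits 0 = []"
  "index_bits (Int.Pos n) = bits n []"
  "index_bits (Int.Neg n) = []"
  by (simp_all add: index_bits_def num_of_nat_numeral_eq)

fun bin :: "nat \<Rightarrow> nat \<Rightarrow> bool list" where
  "bin 0 j = []"
| "bin (Suc d) j = (if j < 2 ^ d then False # bin d j else True # bin d (j - 2 ^ d))"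

text \<open>\<open>bin\<close> splits off the most significant digit, a \<open>num\<close> the least
  significant one; this mediates between the two.\<close>

lemma bin_snoc: "j < 2 ^ d \<Longrightarrow> bin (Suc d) (2 * j + of_bool b) = bin d j @ [b]"
proof (induction d arbitrary: j)
  case (Suc d)
  show ?case
  proof (cases "j < 2 ^ d")
    case True
    then have "2 * j + of_bool b < 2 ^ Suc d" by (cases b) simp_all
    then have "bin (Suc (Suc d)) (2 * j + of_bool b) = False # bin (Suc d) (2 * j + of_bool b)" 
      by (simp only: bin.simps if_True)
    then show ?thesis using True Suc.IH[OF True] by simp
  next
    case False
    then have eq: "2 * j + of_bool b - 2 ^ Suc d = 2 * (j - 2 ^ d) + of_bool b" by (cases b) auto
    have "\<not> 2 * j + of_bool b < 2 ^ Suc d" using False by (cases b) simp_all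
    then have "bin (Suc (Suc d)) (2 * j + of_bool b) = True # bin (Suc d) (2 * (j - 2 ^ d) + of_bool b)" 
      by (simp only: bin.simps if_False eq)
    moreover have "j - 2 ^ d < 2 ^ d" using Suc.prems by simp
    ultimately show ?thesis using False Suc.IH[of "j - 2 ^ d"] by simp
  qed
qed (cases b; simp)

lemma bits_append: "bits n bs = bits n [] @ bs"
proof (induction n arbitrary: bs)
  case (Bit0 n)
  show ?case using Bit0[of "False # bs"] Bit0[of "[False]"] by simp
next
  case (Bit1 n)
  show ?case using Bit1[of "True # bs"] Bit1[of "[True]"] by simp
qed simp

lemma bits_eq: "\<exists>d. \<exists>j < 2 ^ d. nat_of_num n = 2 ^ d + j \<and> bits n [] = bin d j"
proof (induction n)
  case One
  show ?case by (rule exI[of _ 0]) simp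
next
  case (Bit0 n)
  then obtain d j where "j < 2 ^ d" "nat_of_num n = 2 ^ d + j" "bits n [] = bin d j" by blast
  then show ?case using bin_snoc[of j d False] bits_append[of n "[False]"]
    by (intro exI[of _ "Suc d"] exI[of _ "2 * j"]) simp
next
  case (Bit1 n)
  then obtain d j where "j < 2 ^ d" "nat_of_num n = 2 ^ d + j" "bits n [] = bin d j" by blast
  then show ?case using bin_snoc[of j d True] bits_append[of n "[True]"]
    by (intro exI[of _ "Suc d"] exI[of _ "Suc (2 * j)"]) simp
qed

lemma pow2_decomp_unique:
  assumes "(2::nat) ^ d + j = 2 ^ e + i" "j < 2 ^ d" "i < 2 ^ e"
  shows "d = e \<and> j = i"
proof (cases d e rule: linorder_cases)
  case less
  then have "(2::nat) ^ Suc d \<le> 2 ^ e" by (intro power_increasing) auto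
  then show ?thesis using assms by simp
next
  case greater
  then have "(2::nat) ^ Suc e \<le> 2 ^ d" by (intro power_increasing) auto
  then show ?thesis using assms by simp
qed (use assms in simp)

lemma index_bits_eq:
  assumes "j < 2 ^ d"
  shows "index_bits (int j + 2 ^ d) = bin d j"
proof -
  have pos: "int j + 2 ^ d > 0" by (simp add: add_nonneg_pos)
  have "nat (int j + 2 ^ d) = j + 2 ^ d" by (simp add: nat_add_distrib nat_power_eq)
  then have "nat_of_num (num_of_nat (nat (int j + 2 ^ d))) = 2 ^ d + j"
    by (simp add: num_of_nat_inverse)
  with bits_eq[of "num_of_nat (nat (int j + 2 ^ d))"] obtain e i where
    "i < 2 ^ e" "2 ^ d + j = 2 ^ e + i" "bits (num_of_nat (nat (int j + 2 ^ d))) [] = bin e i" by auto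
  with pow2_decomp_unique[OF this(2) assms this(1)] pos show ?thesis by (simp add: index_bits_def)
qed

text \<open>The tree built, the state for the next residue and the number of residues still to be
  placed.\<close>

type_synonym growth = "trie \<times> (int \<times> int) list \<times> int"

fun join :: "trie \<Rightarrow> growth \<Rightarrow> growth" where
  "join l (r, st) = (Branch l r, st)"

text \<open>
  These functions are evaluated by the simplifier. It would normalise the branches of an \<open>if\<close> again after
  choosing one, which is expensive for large arguments; hence the auxiliary functions with a
  Boolean argument.
\<close>

function grow :: "nat \<Rightarrow> kind \<Rightarrow> int \<Rightarrow> (int \<times> int) list \<Rightarrow> int \<Rightarrow> growth" 
  and grow_if :: "bool \<Rightarrow> nat \<Rightarrow> kind \<Rightarrow> int \<Rightarrow> (int \<times> int) list \<Rightarrow> int \<Rightarrow> growth" 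
  and grow_right :: "nat \<Rightarrow> kind \<Rightarrow> int \<Rightarrow> growth \<Rightarrow> growth" where
  "grow d k M ps n = grow_if (n > 0) d k M ps n"
| "grow_if False d k M ps n = (Tip, ps, n)"
| "grow_if True 0 k M ps n = (Cell (row k M ps), advance k M ps, n - 1)"
| "grow_if True (Suc d) k M ps n = grow_right d k M (grow d k M ps n)"
| "grow_right d k M (l, ps, n) = join l (grow d k M ps n)"
  by pat_completeness auto
termination
  by (relation "measure (case_sum (\<lambda>(d, _). 3 * d + 1) (case_sum (\<lambda>(_, d, _). 3 * d) (\<lambda>(d, _). 3 * d + 2)))") auto

declare grow.simps [simp del]

lemma grow_spec:
  assumes "M > 0"
  shows "\<exists>t. grow d k M (seeds_at k M hs a) (int n) =
      (t, seeds_at k M hs (a + min n (2 ^ d)), int (n - min n (2 ^ d))) \<and>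
    (\<forall>j < min n (2 ^ d). look t (bin d j) = row_at k M hs (a + j))"
proof (induction d arbitrary: a n)
  case 0
  show ?case by (cases n) (simp_all add: grow.simps advance_seeds row_seeds assms)
next
  case (Suc d)
  show ?case
  proof (cases "n = 0")
    case False
    from Suc.IH[of a n] obtain l where l: "grow d k M (seeds_at k M hs a) (int n) =
        (l, seeds_at k M hs (a + min n (2 ^ d)), int (n - min n (2 ^ d)))"
      "\<forall>j < min n (2 ^ d). look l (bin d j) = row_at k M hs (a + j)" by blast
    let ?a = "a + min n (2 ^ d)" and ?n = "n - min n (2 ^ d)"
    from Suc.IH[of ?a ?n] obtain r where r: "grow d k M (seeds_at k M hs ?a) (int ?n) =
        (r, seeds_at k M hs (?a + min ?n (2 ^ d)), int (?n - min ?n (2 ^ d)))"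
      "\<forall>j < min ?n (2 ^ d). look r (bin d j) = row_at k M hs (?a + j)" by blast
    \<comment> \<open>The left subtree takes as many residues as it can hold, the right one as many
      of the rest.\<close>
    have s: "min n (2 ^ Suc d) = min n (2 ^ d) + min ?n (2 ^ d)" by (auto simp: min_def)
    have "grow (Suc d) k M (seeds_at k M hs a) (int n) = grow_right d k M (grow d k M (seeds_at k M hs a) (int n))"
      using False by (subst grow.simps) simp
    also have "\<dots> = (Branch l r, seeds_at k M hs (a + min n (2 ^ Suc d)), int (n - min n (2 ^ Suc d)))"
      unfolding l(1) grow_right.simps r(1) s by (simp add: add.assoc)
    finally have 1: "grow (Suc d) k M (seeds_at k M hs a) (int n) = \<dots>" .
    have "look (Branch l r) (bin (Suc d) j) = row_at k M hs (a + j)" if "j < min n (2 ^ Suc d)" for j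
    proof (cases "j < 2 ^ d")
      case True
      then show ?thesis using that l(2) by simp
    next
      case ge: False
      then have "j - 2 ^ d < min ?n (2 ^ d)" "min n (2 ^ d) = 2 ^ d" using that by auto
      then show ?thesis using ge r(2) by simp
    qed
    with 1 show ?thesis by blast
  qed (simp add: grow.simps)
qed

text \<open>
  A table assigns to a residue \<open>i\<close> modulo \<open>N\<close> the residues modulo \<open>N * r\<close> above it, each with the value
  modulo \<open>M\<close> there. A \<open>Wheel\<close> only stores \<open>q\<close> values, where the sequence has period \<open>P\<close> modulo \<open>M\<close>, and
  either \<open>P = q\<close>, or \<open>P = 2 * q\<close> and a shift by \<open>q\<close> changes the sign. A \<open>Direct\<close> table stores the values
  next to \<open>0\<close> and \<open>N\<close>, because most classes surviving for large \<open>N\<close> come from actual solutions,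
  possibly with negative indices.
\<close>

datatype tab =
    Full int "int list" trie
  | Wheel int int int int "int list" trie
  | Direct kind int "int list" "int \<times> int" seeds

fun fetch :: "kind \<Rightarrow> int \<Rightarrow> int \<Rightarrow> seeds \<Rightarrow> int \<times> int" 
and fetch_if :: "bool \<Rightarrow> int \<times> int \<Rightarrow> kind \<Rightarrow> int \<Rightarrow> int \<Rightarrow> seeds \<Rightarrow> int \<times> int" where
  "fetch k M a [] = pair_at k M a"
| "fetch k M a ((i, p) # ps) = fetch_if (i = a) p k M a ps"
| "fetch_if True p k M a ps = p"
| "fetch_if False p k M a ps = fetch k M a ps"

text \<open>Here \<open>q\<close> represents the generator to the power \<open>N\<close>, so one
  product leads from each lift to the next. The separate case of a single lift saves the last
  product.\<close>

fun spread :: "kind \<Rightarrow> int \<Rightarrow> int list \<Rightarrow> int \<times> int \<Rightarrow> int \<Rightarrow> int \<times> int \<Rightarrow> entry" where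
  "spread k M [] q a p = []"
| "spread k M [h] q a p = [(a + h, val k M p)]"
| "spread k M (h # h' # hs) q a p = (a + h, val k M p) # spread k M (h' # hs) q a (pair_mul M p q)"

fun label :: "int \<Rightarrow> int list \<Rightarrow> int list \<Rightarrow> entry" where
  "label i (h # hs) (v # vs) = (i + h, v) # label i hs vs"
| "label i hs vs = []"

fun first :: "int list \<Rightarrow> int" where
  "first [] = 0"
| "first (v # vs) = v"

fun opposite :: "int \<Rightarrow> int \<Rightarrow> int" where
  "opposite M v = (if v = 0 then 0 else M - v)"

fun wheel_val :: "bool \<Rightarrow> int \<Rightarrow> int \<Rightarrow> int \<Rightarrow> trie \<Rightarrow> int \<Rightarrow> int" where
  "wheel_val True M q D t j = first (look t (index_bits (j + D)))"
| "wheel_val False M q D t j = opposite M (first (look t (index_bits (j - q + D))))"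

fun wheel_at :: "int \<Rightarrow> int \<Rightarrow> int \<Rightarrow> trie \<Rightarrow> int \<Rightarrow> int" where
  "wheel_at M q D t j = wheel_val (j < q) M q D t j"

fun wheel_vals :: "int \<Rightarrow> int \<Rightarrow> int \<Rightarrow> int \<Rightarrow> trie \<Rightarrow> int \<Rightarrow> int list \<Rightarrow> entry" where
  "wheel_vals M P q D t i [] = []"
| "wheel_vals M P q D t i (h # hs) = (i + h, wheel_at M q D t ((i + h) mod P)) # wheel_vals M P q D t i hs"

fun vals :: "tab \<Rightarrow> int \<Rightarrow> entry" where
  "vals (Full D hs t) i = label i hs (look t (index_bits (i + D)))"
| "vals (Wheel M P q D hs t) i = wheel_vals M P q D t i hs"
| "vals (Direct k M hs q ps) i = spread k M hs q i (fetch k M i ps)"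

lemma label_map: "label i hs (map f hs) = map (\<lambda>h. (i + h, f h)) hs"
  by (induction hs) simp_all

section \<open>Building the tables\<close>

definition mults :: "int \<Rightarrow> int \<Rightarrow> int list" where
  "mults N r = map ((*) N) [0..r - 1]"

fun depth :: "int \<Rightarrow> nat" where
  "depth N = (if N \<le> 1 then 0 else Suc (depth ((N + 1) div 2)))"
declare depth.simps [simp del]

lemma depth_bound: "N \<le> 2 ^ depth N"
proof (induction N rule: depth.induct)
  case (1 N)
  show ?case
  proof (cases "N \<le> 1")
    case True
    then show ?thesis using one_le_power[of "2::int" "depth N"] by linarith
  next
    case False
    with 1 have "(N + 1) div 2 \<le> 2 ^ depth ((N + 1) div 2)" by blast
    then show ?thesis using False by (subst depth.simps) simp
  qed
qed

definition full :: "kind \<Rightarrow> int \<Rightarrow> int \<Rightarrow> int \<Rightarrow> tab" where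
  "full k M N r = Full (2 ^ depth N) (mults N r) (fst (grow (depth N) k M (pairs_at k M (mults N r)) N))"

fun trail :: "kind \<Rightarrow> int \<Rightarrow> int list \<Rightarrow> int \<times> int \<Rightarrow> seeds" where
  "trail k M [] p = []"
| "trail k M (i # js) p = (i, p) # trail k M js (succ_pair k M p)"

text \<open>Often \<open>N\<close> is half a period and the factor is \<open>M - 1\<close>; multiplying by \<open>-1\<close> is much faster.\<close>

fun balance :: "int \<Rightarrow> int \<times> int \<Rightarrow> int \<times> int" where
  "balance M (x, y) = (x, if y = M - 1 then -1 else y)"

text \<open>Residues just below \<open>N\<close> stand for negative indices. Fibonacci numbers are
  still integers there, powers of 2 are not.\<close>

fun trail_back :: "kind \<Rightarrow> int \<Rightarrow> int \<Rightarrow> seeds" where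
  "trail_back Fibonacci M N = trail Fibonacci M [N - 24..N - 1] (pair_at Fibonacci M (N - 24))"
| "trail_back Power M N = []"

definition direct :: "kind \<Rightarrow> int \<Rightarrow> int \<Rightarrow> int \<Rightarrow> tab" where
  "direct k M N r = Direct k M (mults N r) (balance M (pair_at k M N))
     (trail k M [0..24] (pair_at k M 0) @ trail_back k M N)"

definition wheel :: "kind \<Rightarrow> int \<Rightarrow> int \<Rightarrow> int \<Rightarrow> int \<Rightarrow> int \<Rightarrow> tab" where
  "wheel k M P q N r = Wheel M P q (2 ^ depth q) (mults N r) (fst (grow (depth q) k M [pair_at k M 0] q))"

datatype layout = Plain | Cyclic int int | Near

fun table :: "layout \<Rightarrow> kind \<Rightarrow> int \<Rightarrow> int \<Rightarrow> int \<Rightarrow> tab" where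
  "table Plain k M N r = full k M N r"
| "table (Cyclic P q) k M N r = wheel k M P q N r"
| "table Near k M N r = direct k M N r"

definition covers :: "int \<Rightarrow> int \<Rightarrow> kind \<Rightarrow> int \<Rightarrow> tab \<Rightarrow> bool" where
  "covers N N' k M T \<longleftrightarrow> (\<forall>m. (int m mod N', weight k m mod M) \<in> set (vals T (int m mod N)))"

lemma mod_mult_split:
  fixes m N r :: int
  assumes "N > 0" "r > 0"
  obtains l where "0 \<le> l" "l < r" "m mod (N * r) = m mod N + N * l"
proof
  show "m mod (N * r) = m mod N + N * (m div N mod r)"
    using zmod_zmult2_eq[of r m N] assms by simp
qed (use assms in auto)

lemma covers_full:
  assumes "M > 0" "N > 0" "r > 0" "residue k M (nat (N * r)) = residue k M 0"
  shows "covers N (N * r) k M (full k M N r)"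
  unfolding covers_def
proof
  fix m
  define a where "a = m mod nat N"
  have a: "int m mod N = int a" "a < nat N" using assms(2) by (simp_all add: a_def zmod_int)
  have N: "nat N \<le> 2 ^ depth N" using depth_bound[of N] by (simp add: nat_le_iff)
  from grow_spec[OF assms(1), of "depth N" k "mults N r" 0 "nat N"] obtain t where
    "fst (grow (depth N) k M (pairs_at k M (mults N r)) N) = t"
    "\<forall>j < nat N. look t (bin (depth N) j) = row_at k M (mults N r) j"
    using assms(2) N by (auto simp: pairs_at_eq min_def)
  with a have vals: "vals (full k M N r) (int m mod N) = label (int a) (mults N r) (row_at k M (mults N r) a)"
    using index_bits_eq[of a "depth N"] N by (simp add: full_def del: depth.simps)
  obtain l where l: "0 \<le> l" "l < r" "int m mod (N * r) = int m mod N + N * l"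
    using mod_mult_split[OF assms(2,3)] .
  have "nat (N * l) + a = nat (int m mod (N * r))" using l assms(2) a by (simp add: nat_add_distrib)
  also have "\<dots> = m mod nat (N * r)" using assms by (simp add: nat_mod_distrib)
  finally have "weight k (nat (N * l) + a) mod M = weight k m mod M"
    using weight_periodic[OF assms(1,4)] by simp
  moreover have "(int a + N * l, weight k (nat (N * l) + a) mod M)
      \<in> set (label (int a) (mults N r) (row_at k M (mults N r) a))"
    unfolding row_at_def label_map mults_def using l by (auto simp: image_image intro!: rev_image_eqI[of l])
  ultimately show "(int m mod (N * r), weight k m mod M) \<in> set (vals (full k M N r) (int m mod N))"
    using l(3) a(1) vals by simp
qed

lemma fetch_residue:
  assumes "\<And>i p. (i, p) \<in> set ps \<Longrightarrow> p = pair_at k M i"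
  shows "fetch k M a ps = pair_at k M a"
  using assms by (induction ps) (auto split: bool.splits, metis (full_types) fetch_if.simps)

lemma trail_residue:
  assumes "M > 0" "i \<ge> 0" "(j, p) \<in> set (trail k M [i..n] (pair_at k M i))"
  shows "p = pair_at k M j"
  using assms(2,3)
proof (induction i n rule: upto.induct)
  case (1 i n)
  show ?case
  proof (cases "i \<le> n")
    case True
    have "succ_pair k M (pair_at k M i) = pair_at k M (i + 1)"
      using 1(2) by (simp add: pair_at_def succ_pair_residue assms(1) nat_add_distrib)
    with 1 True show ?thesis by (auto simp: upto.simps[of i n])
  qed (use 1 in simp)
qed

lemma spread_mem:
  assumes "a \<ge> 0" "N \<ge> 0" "M > 0" "reduce M q = residue k M (nat N)"
    and "0 \<le> j" "j \<le> l" "l \<le> n" "p = residue k M (nat (a + N * j))"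
  shows "(a + N * l, weight k (nat (a + N * l)) mod M) \<in> set (spread k M (map ((*) N) [j..n]) q a p)"
  using assms(5-8)
proof (induction j n arbitrary: p rule: upto.induct)
  case (1 j n)
  have u: "[j..n] = j # [j + 1..n]" using 1 by (simp add: upto.simps[of j n])
  show ?case
  proof (cases "j = l")
    case True
    then show ?thesis using 1 u by (cases "[j + 1..n]") (auto simp: val_residue assms(3))
  next
    case False
    then have j: "j + 1 \<le> l" "j + 1 \<le> n" using 1 by auto
    have u': "[j + 1..n] = (j + 1) # [j + 2..n]" by (subst upto.simps) (use j in \<open>simp add: add.commute\<close>)
    have nj: "nat (a + N * (j + 1)) = nat (a + N * j) + nat N"
      using assms(1,2) 1(2) by (simp add: distrib_left nat_add_distrib)
    have "pair_mul M p q = residue k M (nat (a + N * (j + 1)))"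
      unfolding nj using 1 assms(4) by (intro pair_mul_residue) simp_all
    with 1 j have "(a + N * l, weight k (nat (a + N * l)) mod M)
      \<in> set (spread k M (map ((*) N) [j + 1..n]) q a (pair_mul M p q))" by auto
    then show ?thesis by (simp add: u u')
  qed
qed

lemma covers_direct:
  assumes "M > 0" "N \<ge> 24" "r > 0" "residue k M (nat (N * r)) = residue k M 0"
  shows "covers N (N * r) k M (direct k M N r)"
  unfolding covers_def
proof
  fix m
  have N: "N > 0" using assms by simp
  obtain l where l: "0 \<le> l" "l < r" "int m mod (N * r) = int m mod N + N * l"
    using mod_mult_split[OF N assms(3)] .
  define a where "a = int m mod N"
  have a: "a \<ge> 0" using N by (simp add: a_def)
  have trail: "p = pair_at k M i"
    if "(i, p) \<in> set (trail k M [0..24] (pair_at k M 0) @ trail_back k M N)" for i p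
    using that trail_residue[of M 0 i p k 24] trail_residue[of M "N - 24" i p k "N - 1"] assms
    by (cases k) auto
  have fetch: "fetch k M a (trail k M [0..24] (pair_at k M 0) @ trail_back k M N) = pair_at k M a"
    by (rule fetch_residue) (rule trail)
  have "reduce M (balance M (pair_at k M N)) = residue k M (nat N)"
  proof -
    \<comment> \<open>Replacing \<open>M - 1\<close> by -1 does not change the class.\<close>
    have "reduce M (balance M p) = reduce M p" for p
      by (cases p) (simp add: zmod_minus1 assms mod_diff_left_eq[symmetric] zmod_zminus1_eq_if)
    then show ?thesis by (simp add: pair_at_def)
  qed
  with a N assms(1) l have "(a + N * l, weight k (nat (a + N * l)) mod M) \<in> set (vals (direct k M N r) a)"
    unfolding direct_def vals.simps mults_def fetch
    by (intro spread_mem) (simp_all add: pair_at_def)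
  moreover have "nat (a + N * l) = m mod nat (N * r)"
    using l N assms(3) by (simp add: a_def nat_mod_distrib flip: l(3))
  ultimately show "(int m mod (N * r), weight k m mod M) \<in> set (vals (direct k M N r) (int m mod N))"
    using weight_periodic[OF assms(1,4)] l by (simp add: a_def)
qed

lemma wheel_vals_mem: "h \<in> set hs \<Longrightarrow> (i + h, wheel_at M q D t ((i + h) mod P)) \<in> set (wheel_vals M P q D t i hs)"
  by (induction hs) (auto simp del: wheel_at.simps)

lemma wheel_at_eq:
  assumes "M > 0" "q > 0" "0 \<le> j" "j < q \<or> j < 2 * q \<and> residue k M (nat q) = reduce M (0, -1)"
  shows "wheel_at M q (2 ^ depth q) (fst (grow (depth q) k M [pair_at k M 0] q)) j = weight k (nat j) mod M"
proof -
  have q: "nat q \<le> 2 ^ depth q" using depth_bound[of q] by (simp add: nat_le_iff)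
  from grow_spec[OF assms(1), of "depth q" k "[0]" 0 "nat q"] obtain t where
    t: "fst (grow (depth q) k M [pair_at k M 0] q) = t"
    "\<forall>j < nat q. look t (bin (depth q) j) = row_at k M [0] j"
    using assms(2) q by (auto simp: seeds_at_def pair_at_def min_def)
  have look: "first (look t (index_bits (i + 2 ^ depth q))) = weight k (nat i) mod M" if "0 \<le> i" "i < q" for i
  proof -
    have "index_bits (int (nat i) + 2 ^ depth q) = bin (depth q) (nat i)"
      using that q by (intro index_bits_eq) linarith
    then show ?thesis using that t(2) by (simp add: row_at_def)
  qed
  show ?thesis
  proof (cases "j < q")
    case True
    then show ?thesis using look assms(3) by (simp add: t)
  next
    case False
    then have j: "0 \<le> j - q" "j - q < q" "residue k M (nat q) = reduce M (0, -1)" using assms(4) by auto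
    have "nat j = nat (j - q) + nat q" using False assms(2) by simp
    then have "weight k (nat j) mod M = (- weight k (nat (j - q))) mod M"
      using weight_antiperiodic[OF j(3)] by simp
    then show ?thesis using False look[OF j(1,2)] by (simp add: t zmod_zminus1_eq_if)
  qed
qed

text \<open>\<open>P\<close> and \<open>N * r\<close> are each known to be periods, so an index may
  be reduced modulo \<open>N * r\<close> first and modulo \<open>P\<close> afterwards.\<close>

lemma covers_wheel:
  assumes "M > 0" "N > 0" "r > 0" "residue k M (nat (N * r)) = residue k M 0"
    and "q > 0" "P > 0" "residue k M (nat P) = residue k M 0"
    and "P = q \<or> P = 2 * q \<and> residue k M (nat q) = reduce M (0, -1)"
  shows "covers N (N * r) k M (wheel k M P q N r)"
  unfolding covers_def
proof
  fix m
  obtain l where l: "0 \<le> l" "l < r" "int m mod (N * r) = int m mod N + N * l"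
    using mod_mult_split[OF assms(2,3)] .
  define x where "x = int m mod (N * r)"
  have x: "x \<ge> 0" "nat x = m mod nat (N * r)" using assms(2,3) by (simp_all add: x_def nat_mod_distrib)
  have "N * l \<in> set (mults N r)" using l by (auto simp: mults_def)
  from wheel_vals_mem[OF this, of "int m mod N"]
  have "(x, wheel_at M q (2 ^ depth q) (fst (grow (depth q) k M [pair_at k M 0] q)) (x mod P))
      \<in> set (vals (wheel k M P q N r) (int m mod N))"
    by (simp add: wheel_def x_def l(3) del: wheel_at.simps)
  also have "wheel_at M q (2 ^ depth q) (fst (grow (depth q) k M [pair_at k M 0] q)) (x mod P) =
      weight k (nat (x mod P)) mod M"
    using assms(1,5,6,8) pos_mod_bound[of P x] by (intro wheel_at_eq) auto
  also have "nat (x mod P) = nat x mod nat P" using x(1) assms(6) by (simp add: nat_mod_distrib)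
  also have "weight k (nat x mod nat P) mod M = weight k (nat x) mod M"
    by (rule weight_periodic[OF assms(1,7)])
  also have "\<dots> = weight k m mod M" unfolding x(2) by (rule weight_periodic[OF assms(1,4)])
  finally show "(int m mod (N * r), weight k m mod M) \<in> set (vals (wheel k M P q N r) (int m mod N))"
    unfolding x_def .
qed

text \<open>The bound 24 keeps \<open>N - 24\<close>, the first residue stored below
  \<open>N\<close>, from being negative.\<close>

fun suits :: "layout \<Rightarrow> kind \<Rightarrow> int \<Rightarrow> int \<Rightarrow> bool" where
  "suits Plain k M N \<longleftrightarrow> True"
| "suits (Cyclic P q) k M N \<longleftrightarrow> q > 0 \<and> P > 0 \<and> pair_at k M P = pair_at k M 0 \<and>
    (P = q \<or> P = 2 * q \<and> pair_at k M q = (0, -1 mod M))"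
| "suits Near k M N \<longleftrightarrow> N \<ge> 24"

definition periodic :: "layout \<Rightarrow> kind \<Rightarrow> int \<Rightarrow> int \<Rightarrow> int \<Rightarrow> bool" where
  "periodic L k M N r \<longleftrightarrow>
    M > 0 \<and> N > 0 \<and> r > 0 \<and> pair_at k M (N * r) = pair_at k M 0 \<and> suits L k M N"

lemma covers_table:
  assumes "periodic L k M N r"
  shows "covers N (N * r) k M (table L k M N r)"
proof (cases L)
  case Plain
  then show ?thesis using assms covers_full[of M N r k] by (simp add: periodic_def pair_at_def)
next
  case (Cyclic P q)
  then show ?thesis using assms covers_wheel[of M N r k q P] by (simp add: periodic_def pair_at_def)
next
  case Near
  then show ?thesis using assms covers_direct[of M N r k] by (simp add: periodic_def pair_at_def)
qed

section \<open>Refining residue classes\<close>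

text \<open>Only an initial run of smaller residues is removed. Entries are increasing, so this is
  all of them; a residue \<open>i \<ge> k\<close> is never lost.\<close>

fun drop_below :: "int \<Rightarrow> entry \<Rightarrow> entry" and drop_if :: "bool \<Rightarrow> int \<Rightarrow> entry \<Rightarrow> entry" where
  "drop_below k [] = []"
| "drop_below k ((i, v) # xs) = drop_if (i < k) k ((i, v) # xs)"
| "drop_if True k (x # xs) = drop_below k xs"
| "drop_if b k xs = xs"

fun restrict :: "bool \<Rightarrow> int \<Rightarrow> entry \<Rightarrow> entry" where
  "restrict True k xs = drop_below k xs"
| "restrict False k xs = xs"

lemma drop_below_mem: "(i, v) \<in> set xs \<Longrightarrow> k \<le> i \<Longrightarrow> (i, v) \<in> set (drop_below k xs)"
proof (induction xs)
  case (Cons x xs)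
  then show ?case by (cases x; cases "fst x < k") auto
qed simp

lemma restrict_mem:
  assumes "(i, v) \<in> set xs" "tie \<longrightarrow> k \<le> i"
  shows "(i, v) \<in> set (restrict tie k xs)"
  using assms by (cases tie) (simp_all add: drop_below_mem)

fun minus_mod :: "int \<Rightarrow> int \<Rightarrow> int \<Rightarrow> int" where
  "minus_mod M w v = (if w < v then w - v + M else w - v)"

lemma minus_mod_eq:
  assumes "M > 0"
  shows "minus_mod M (x mod M) (y mod M) = (x - y) mod M"
proof -
  have x: "0 \<le> x mod M" "x mod M < M" and y: "0 \<le> y mod M" "y mod M < M" using assms by simp_all
  have "(x - y) mod M = (x mod M - y mod M) mod M" by (simp add: mod_diff_eq)
  also have "\<dots> = minus_mod M (x mod M) (y mod M)"
  proof (cases "x mod M < y mod M")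
    case True
    have "(x mod M - y mod M) mod M = (x mod M - y mod M + M) mod M" by simp
    also have "\<dots> = x mod M - y mod M + M" using x y True by (intro mod_pos_pos_trivial) linarith+
    finally show ?thesis using True by simp
  next
    case False
    then have "(x mod M - y mod M) mod M = x mod M - y mod M"
      using x y by (intro mod_pos_pos_trivial) linarith+
    then show ?thesis using False by simp
  qed
  finally show ?thesis by simp
qed

fun add_if :: "bool \<Rightarrow> 'a \<Rightarrow> 'a list \<Rightarrow> 'a list" where
  "add_if True x acc = x # acc"
| "add_if False x acc = acc"

text \<open>
  Picks one item of \<open>xs\<close> and one of each slot such that the values add up to \<open>w\<close> modulo \<open>M\<close>. A slot marked
  as a tie belongs to the same residue as the preceding one, so by symmetry only
  nondecreasing choices matter.
\<close>

fun loop :: "int \<Rightarrow> int \<Rightarrow> entry \<Rightarrow> (bool \<times> entry) list \<Rightarrow> int list \<Rightarrow> int list list \<Rightarrow> int list list" where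
  "loop M w [] slots pre acc = acc"
| "loop M w ((i, v) # xs) [] pre acc = loop M w xs [] pre (add_if (v = w) (i # pre) acc)"
| "loop M w ((i, v) # xs) ((tie, ys) # slots) pre acc =
    loop M w xs ((tie, ys) # slots) pre (loop M (minus_mod M w v) (restrict tie i ys) slots (i # pre) acc)"

lemma add_if_acc: "set acc \<subseteq> set (add_if b x acc)"
  by (cases b) auto

lemma loop_acc: "set acc \<subseteq> set (loop M w xs slots pre acc)"
  by (induction M w xs slots pre acc rule: loop.induct) (use add_if_acc in \<open>fastforce+\<close>)

lemma loop_last: "(i, w) \<in> set xs \<Longrightarrow> i # pre \<in> set (loop M w xs [] pre acc)"
proof (induction xs arbitrary: acc)
  case (Cons x xs)
  then show ?case using loop_acc[of "add_if (snd x = w) (fst x # pre) acc" M w xs "[]" pre]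
    by (cases x) auto
qed simp

text \<open>The inner call must succeed for every accumulator, since its accumulator holds whatever
  was found before. Later calls lose nothing by \<open>loop_acc\<close>.\<close>

lemma loop_more:
  assumes "(i, v) \<in> set xs"
    and "\<And>acc. n \<in> set (loop M (minus_mod M w v) (restrict tie i ys) slots (i # pre) acc)"
  shows "n \<in> set (loop M w xs ((tie, ys) # slots) pre acc)"
  using assms(1)
proof (induction xs arbitrary: acc)
  case (Cons x xs)
  then show ?case
    using assms(2) loop_acc[of "loop M (minus_mod M w v) (restrict tie i ys) slots (i # pre) acc"
        M w xs "(tie, ys) # slots" pre]
    by (cases x) (auto simp del: minus_mod.simps)
qed simp

text \<open>
  A node is a list \<open>[m3, m2, m1, t2, t1]\<close> of residues. \<open>Fib_Last\<close> and \<open>Pow_Last\<close> differ in what is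
  compared last: the innermost loop should run over the variables with several lifts.
\<close>

datatype level = Fib_Last int tab tab | Pow_Last int tab tab | Two_Adic int tab

text \<open>With the powers innermost, \<open>loop\<close> yields
  \<open>[t2, t1, m3, m2, m1]\<close>; this restores the order of a node.\<close>

fun rotate_nodes :: "int list list \<Rightarrow> int list list \<Rightarrow> int list list" where
  "rotate_nodes [] acc = acc"
| "rotate_nodes ((t # s # n) # ns) acc = rotate_nodes ns ((n @ [t, s]) # acc)"
| "rotate_nodes (n # ns) acc = rotate_nodes ns acc"

lemma rotate_mem: "(t # s # n) \<in> set ns \<or> n @ [t, s] \<in> set acc \<Longrightarrow> n @ [t, s] \<in> set (rotate_nodes ns acc)"
  by (induction ns acc rule: rotate_nodes.induct) auto

lemma rotate_acc: "set acc \<subseteq> set (rotate_nodes ns acc)"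
  by (induction ns acc rule: rotate_nodes.induct) auto

fun add_target :: "int \<Rightarrow> int \<Rightarrow> int list \<Rightarrow> int list" where
  "add_target E s ws = (if s < 13 then (if 2 ^ nat s mod E = 0 then ws else (2 ^ nat s mod E) # ws) else ws)"

text \<open>Modulo a divisor \<open>E\<close> of \<open>2 ^ 13\<close> one of the two powers is 0.
  The other is 0 as well, or its exponent is below 13 and therefore equal to its residue
  \<open>s\<close> or \<open>t\<close>.\<close>

fun targets :: "int \<Rightarrow> int \<Rightarrow> int \<Rightarrow> int list" where
  "targets E s t = (if s = t then add_target E s [0] else add_target E s (add_target E t [0]))"

fun try_all :: "int \<Rightarrow> int list \<Rightarrow> entry \<Rightarrow> (bool \<times> entry) list \<Rightarrow> int list \<Rightarrow> int list list \<Rightarrow> int list list" where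
  "try_all M [] xs slots pre acc = acc"
| "try_all M (w # ws) xs slots pre acc = try_all M ws xs slots pre (loop M w xs slots pre acc)"

lemma try_all_acc: "set acc \<subseteq> set (try_all M ws xs slots pre acc)"
  using loop_acc by (induction ws arbitrary: acc) (simp, fastforce)

lemma try_all_mem:
  assumes "w \<in> set ws" "\<And>acc. n \<in> set (loop M w xs slots pre acc)"
  shows "n \<in> set (try_all M ws xs slots pre acc)"
  using assms(1)
proof (induction ws arbitrary: acc)
  case (Cons w' ws)
  then show ?case using assms(2) try_all_acc[of "loop M w xs slots pre acc" M ws xs slots pre] by auto
qed simp

fun step :: "level \<Rightarrow> int list \<Rightarrow> int list list \<Rightarrow> int list list" where
  "step (Fib_Last M F P) [c, b, a, t, s] acc =
    loop M 0 (vals P s) [(s = t, vals P t), (False, vals F a), (a = b, vals F b), (b = c, vals F c)] [] acc"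
| "step (Pow_Last M F P) [c, b, a, t, s] acc =
    rotate_nodes (loop M 0 (vals F a) [(a = b, vals F b), (b = c, vals F c), (False, vals P s), (s = t, vals P t)] [] []) acc"
| "step (Two_Adic E F) [c, b, a, t, s] acc =
    try_all E (targets E s t) (vals F a) [(a = b, vals F b), (b = c, vals F c)] [t, s] acc"
| "step l n acc = acc"

lemma step_acc: "set acc \<subseteq> set (step l n acc)"
  by (cases "(l, n, acc)" rule: step.cases) (simp_all add: loop_acc rotate_acc try_all_acc)

text \<open>No order is imposed, because the sieve sorts by residues; hence either exponent may be
  the large one.\<close>

definition large_solution :: "nat \<Rightarrow> nat \<Rightarrow> nat \<Rightarrow> nat \<Rightarrow> nat \<Rightarrow> bool" where
  "large_solution m1 m2 m3 t1 t2 \<longleftrightarrow>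
    fib m1 + fib m2 + fib m3 = 2 ^ t1 + 2 ^ t2 \<and> (13 \<le> t1 \<or> 13 \<le> t2)"

definition node :: "int \<Rightarrow> int \<Rightarrow> nat \<Rightarrow> nat \<Rightarrow> nat \<Rightarrow> nat \<Rightarrow> nat \<Rightarrow> int list" where
  "node N P m1 m2 m3 t1 t2 = [int m3 mod N, int m2 mod N, int m1 mod N, int t2 mod P, int t1 mod P]"

fun refines :: "int \<Rightarrow> int \<Rightarrow> int \<Rightarrow> int \<Rightarrow> level \<Rightarrow> bool" where
  "refines N P N' P' (Fib_Last M F T) \<longleftrightarrow> M > 0 \<and> covers N N' Fibonacci M F \<and> covers P P' Power M T"
| "refines N P N' P' (Pow_Last M F T) \<longleftrightarrow> M > 0 \<and> covers N N' Fibonacci M F \<and> covers P P' Power M T"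
| "refines N P N' P' (Two_Adic E F) \<longleftrightarrow> E > 0 \<and> 2 ^ 13 mod E = 0 \<and> 13 \<le> P \<and> P' = P \<and> covers N N' Fibonacci E F"

section \<open>Completeness of a refinement step\<close>

lemma add_target_mono: "set ws \<subseteq> set (add_target E s ws)"
  by auto

lemma add_target_mem: "0 \<in> set ws \<Longrightarrow> s < 13 \<Longrightarrow> 2 ^ nat s mod E \<in> set (add_target E s ws)"
  by auto

lemma targets_mem:
  assumes "2 ^ 13 mod E = 0" "13 \<le> P" "13 \<le> t1 \<or> 13 \<le> t2"
  shows "(2 ^ t1 + 2 ^ t2) mod E \<in> set (targets E (int t1 mod P) (int t2 mod P))"
proof -
  have big: "2 ^ t mod E = 0" if "13 \<le> t" for t
  proof -
    have "E dvd 2 ^ 13" using assms(1) by (simp add: dvd_eq_mod_eq_0)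
    also have "(2::int) ^ 13 dvd 2 ^ t" using that by (rule le_imp_power_dvd)
    finally show ?thesis by (simp add: dvd_eq_mod_eq_0)
  qed
  have zero: "0 \<in> set (targets E s t)" for s t
    using add_target_mono[of "[0]" E] add_target_mono[of "add_target E t [0]" E s] by auto
  have small: "2 ^ t mod E \<in> set (targets E (int t mod P) u)" "2 ^ t mod E \<in> set (targets E u (int t mod P))"
    if "t < 13" for t u
  proof -
    have t: "int t mod P = int t" using that assms(2) by simp
    have 0: "0 \<in> set (add_target E u [0])" by auto
    show "2 ^ t mod E \<in> set (targets E (int t mod P) u)"
      using add_target_mem[of "[0]" "int t" E] add_target_mem[OF 0, of "int t" E] that
      by (simp only: t targets.simps nat_int) auto
    have "2 ^ t mod E \<in> set (add_target E (int t) [0])"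
      using add_target_mem[of "[0]" "int t" E] that by simp
    then show "2 ^ t mod E \<in> set (targets E u (int t mod P))"
      using add_target_mono[of "add_target E (int t) [0]" E u]
      by (simp only: t targets.simps split: if_split) auto
  qed
  show ?thesis
  proof (cases "13 \<le> t1")
    case True
    then have "(2 ^ t1 + 2 ^ t2) mod E = 2 ^ t2 mod E" using big[of t1] by (simp add: mod_add_left_eq[symmetric])
    then show ?thesis using zero small(2) big[of t2] by (cases "t2 < 13") simp_all
  next
    case False
    then have "(2 ^ t1 + 2 ^ t2) mod E = 2 ^ t1 mod E"
      using big[of t2] assms(3) by (simp add: mod_add_right_eq[symmetric])
    then show ?thesis using small(1) False by simp
  qed
qed

text \<open>Read \<open>g\<close> as the class before a step and \<open>f\<close> as the class after
  it. Permuting indices of equal \<open>g\<close> leaves the node unchanged, so they can be sorted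
  by \<open>f\<close>, as \<open>loop\<close> expects for ties.\<close>

lemma sort_three:
  fixes f g :: "nat \<Rightarrow> int"
  shows "\<exists>a b c. fib a + fib b + fib c = fib x + fib y + fib z \<and> g a = g x \<and> g b = g y \<and> g c = g z \<and>
    (g a = g b \<longrightarrow> f a \<le> f b) \<and> (g b = g c \<longrightarrow> f b \<le> f c)"
proof (cases "g x = g y"; cases "g y = g z")
  assume eq: "g x = g y" "g y = g z"
  consider "f x \<le> f y" "f y \<le> f z" | "f x \<le> f z" "f z \<le> f y" | "f y \<le> f x" "f x \<le> f z"
    | "f y \<le> f z" "f z \<le> f x" | "f z \<le> f x" "f x \<le> f y" | "f z \<le> f y" "f y \<le> f x"
    by linarith
  then show ?thesis
  proof cases
    case 1 then show ?thesis using eq by (intro exI[of _ x] exI[of _ y] exI[of _ z]) simp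
  next
    case 2 then show ?thesis using eq by (intro exI[of _ x] exI[of _ z] exI[of _ y]) simp
  next
    case 3 then show ?thesis using eq by (intro exI[of _ y] exI[of _ x] exI[of _ z]) simp
  next
    case 4 then show ?thesis using eq by (intro exI[of _ y] exI[of _ z] exI[of _ x]) simp
  next
    case 5 then show ?thesis using eq by (intro exI[of _ z] exI[of _ x] exI[of _ y]) simp
  next
    case 6 then show ?thesis using eq by (intro exI[of _ z] exI[of _ y] exI[of _ x]) simp
  qed
next
  assume "g x = g y" "g y \<noteq> g z"
  then show ?thesis
    by (cases "f x \<le> f y") (rule exI[of _ x] exI[of _ y], rule exI[of _ y] exI[of _ x], rule exI[of _ z], simp)+
next
  assume "g x \<noteq> g y" "g y = g z"
  then show ?thesis
    by (cases "f y \<le> f z") (rule exI[of _ x], rule exI[of _ y] exI[of _ z], rule exI[of _ z] exI[of _ y], simp)+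
qed blast

lemma sort_two:
  fixes f g :: "nat \<Rightarrow> int"
  shows "\<exists>a b. {a, b} = {x, y} \<and> (2::nat) ^ a + 2 ^ b = 2 ^ x + 2 ^ y \<and> g a = g x \<and> g b = g y \<and>
    (g a = g b \<longrightarrow> f a \<le> f b)"
proof (cases "g x = g y \<and> f y < f x")
  case True
  then show ?thesis by (intro exI[of _ y] exI[of _ x]) auto
next
  case False
  then show ?thesis by (intro exI[of _ x] exI[of _ y]) auto
qed

text \<open>The solution that is followed may change: exchanging indices or exponents in a common
  class gives another solution with the same node, and the lift of that one is found.\<close>

lemma step_complete:
  assumes sol: "large_solution m1 m2 m3 t1 t2" and l: "refines N P N' P' l"
    and n: "n = node N P m1 m2 m3 t1 t2"
  shows "\<exists>m1 m2 m3 t1 t2. large_solution m1 m2 m3 t1 t2 \<and>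
    (\<forall>acc. node N' P' m1 m2 m3 t1 t2 \<in> set (step l n acc))"
proof -
  obtain a b c where abc: "fib a + fib b + fib c = fib m1 + fib m2 + fib m3"
    "int a mod N = int m1 mod N" "int b mod N = int m2 mod N" "int c mod N = int m3 mod N"
    "int a mod N = int b mod N \<longrightarrow> int a mod N' \<le> int b mod N'"
    "int b mod N = int c mod N \<longrightarrow> int b mod N' \<le> int c mod N'"
    using sort_three[of m1 m2 m3 "\<lambda>m. int m mod N" "\<lambda>m. int m mod N'"] by auto
  obtain s t where st: "{s, t} = {t1, t2}" "(2::nat) ^ s + 2 ^ t = 2 ^ t1 + 2 ^ t2"
    "int s mod P = int t1 mod P" "int t mod P = int t2 mod P"
    "int s mod P = int t mod P \<longrightarrow> int s mod P' \<le> int t mod P'"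
    using sort_two[of t1 t2 "\<lambda>m. int m mod P" "\<lambda>m. int m mod P'"] by blast
  have large: "13 \<le> s \<or> 13 \<le> t" using sol st(1) unfolding large_solution_def by (auto simp: doubleton_eq_iff)
  have eq: "fib a + fib b + fib c = 2 ^ s + 2 ^ t" using sol abc(1) st(2) by (simp add: large_solution_def)
  have sum: "int (fib a) + int (fib b) + int (fib c) = 2 ^ s + 2 ^ t"
    using arg_cong[OF eq, of int] by simp
  have n: "n = [int c mod N, int b mod N, int a mod N, int t mod P, int s mod P]"
    using n abc st by (simp add: node_def)
  have F: "(int m mod N', int (fib m) mod M) \<in> set (vals F (int m mod N))" if "covers N N' Fibonacci M F" for F M m
    using that by (auto simp: covers_def)
  have T: "(int m mod P', - (2 ^ m) mod M) \<in> set (vals T (int m mod P))" if "covers P P' Power M T" for T M m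
    using that by (auto simp: covers_def)
  have "[int c mod N', int b mod N', int a mod N', int t mod P', int s mod P'] \<in> set (step l n acc)" for acc
  proof (cases l)
    case (Fib_Last M F T)
    with l have M: "M > 0" and cov: "covers N N' Fibonacci M F" "covers P P' Power M T" by simp_all
    \<comment> \<open>The left side is the weight of the last index, the right side what
      \<open>loop\<close> still requires after subtracting the other four.\<close>
    have w: "int (fib c) mod M = minus_mod M (minus_mod M (minus_mod M (minus_mod M 0 (- (2 ^ s) mod M))
        (- (2 ^ t) mod M)) (int (fib a) mod M)) (int (fib b) mod M)"
    proof -
      have "int (fib c) = 2 ^ s + 2 ^ t - int (fib a) - int (fib b)" using sum by linarith
      then show ?thesis using minus_mod_eq[OF M, of 0 "- (2 ^ s)"]
        by (simp add: minus_mod_eq[OF M] del: minus_mod.simps)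
    qed
    show ?thesis
      unfolding n Fib_Last step.simps
      by (rule loop_more[OF T[OF cov(2)]], rule loop_more[OF restrict_mem[OF T[OF cov(2)]]], use st in blast,
          rule loop_more[OF restrict_mem[OF F[OF cov(1)]]], blast,
          rule loop_more[OF restrict_mem[OF F[OF cov(1)]]], use abc in blast,
          rule loop_last, rule restrict_mem, fold w, rule F[OF cov(1)], use abc in blast)
  next
    case (Pow_Last M F T)
    with l have M: "M > 0" and cov: "covers N N' Fibonacci M F" "covers P P' Power M T" by simp_all
    have w: "- (2 ^ t) mod M = minus_mod M (minus_mod M (minus_mod M (minus_mod M 0 (int (fib a) mod M))
        (int (fib b) mod M)) (int (fib c) mod M)) (- (2 ^ s) mod M)"
      using minus_mod_eq[OF M, of 0 "int (fib a)"] sum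
      by (simp add: minus_mod_eq[OF M] algebra_simps del: minus_mod.simps)
    have "[int t mod P', int s mod P', int c mod N', int b mod N', int a mod N'] \<in> 
      set (loop M 0 (vals F (int a mod N)) [(int a mod N = int b mod N, vals F (int b mod N)),
        (int b mod N = int c mod N, vals F (int c mod N)), (False, vals T (int s mod P)),
        (int s mod P = int t mod P, vals T (int t mod P))] [] [])"
      by (rule loop_more[OF F[OF cov(1)]], rule loop_more[OF restrict_mem[OF F[OF cov(1)]]], use abc in blast,
          rule loop_more[OF restrict_mem[OF F[OF cov(1)]]], use abc in blast,
          rule loop_more[OF restrict_mem[OF T[OF cov(2)]]], blast,
          rule loop_last, rule restrict_mem, fold w, rule T[OF cov(2)], use st in blast)
    from rotate_mem[OF disjI1[OF this]] show ?thesis by (simp add: n Pow_Last)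
  next
    case (Two_Adic E F)
    with l have E: "E > 0" "2 ^ 13 mod E = 0" "13 \<le> P" "P' = P" and cov: "covers N N' Fibonacci E F" by simp_all
    have w: "int (fib c) mod E = minus_mod E (minus_mod E ((2 ^ s + 2 ^ t) mod E)
        (int (fib a) mod E)) (int (fib b) mod E)"
      by (simp add: minus_mod_eq[OF E(1)] sum[symmetric] del: minus_mod.simps)
    show ?thesis
      unfolding n Two_Adic step.simps \<open>P' = P\<close>
      by (rule try_all_mem[OF targets_mem[OF E(2,3) large]], rule loop_more[OF F[OF cov]],
          rule loop_more[OF restrict_mem[OF F[OF cov]]], use abc in blast,
          rule loop_last, rule restrict_mem, fold w, rule F[OF cov], use abc in blast)
  qed
  moreover have "large_solution a b c s t" using eq large by (simp add: large_solution_def)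
  ultimately show ?thesis unfolding node_def by blast
qed

section \<open>Lists of nodes and soundness of the sieve\<close>

fun refine :: "level \<Rightarrow> int list list \<Rightarrow> int list list \<Rightarrow> int list list" where
  "refine l [] acc = acc"
| "refine l (n # ns) acc = refine l ns (step l n acc)"

fun add_chunk :: "'a list \<Rightarrow> 'a list list \<Rightarrow> 'a list list" where
  "add_chunk [] cs = cs"
| "add_chunk (x # xs) cs = (x # xs) # cs"

text \<open>Each chunk is refined on its own, from an empty accumulator. Chunks that die out vanish,
  so the sieve succeeds when the empty list is left.\<close>

fun stage :: "level \<Rightarrow> int list list list \<Rightarrow> int list list list" where
  "stage l [] = []"
| "stage l (c # cs) = add_chunk (refine l c []) (stage l cs)"

fun singletons :: "'a list list \<Rightarrow> 'a list list" where
  "singletons [] = []"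
| "singletons ([] # cs) = singletons cs"
| "singletons ((x # xs) # cs) = [x] # singletons (xs # cs)"

definition nodes :: "'a list list \<Rightarrow> 'a set" where
  "nodes cs = \<Union> (set ` set cs)"

lemma nodes_simps [simp]:
  "nodes [] = {}" "nodes (c # cs) = set c \<union> nodes cs"
  by (simp_all add: nodes_def)

lemma nodes_add_chunk [simp]: "nodes (add_chunk c cs) = set c \<union> nodes cs"
  by (cases c) simp_all

lemma nodes_singletons [simp]: "nodes (singletons cs) = nodes cs"
  by (induction cs rule: singletons.induct) auto

lemma nodes_append: "nodes (cs @ ds) = nodes cs \<union> nodes ds"
  by (simp add: nodes_def image_Un)

lemma refine_acc: "set acc \<subseteq> set (refine l ns acc)"
  using step_acc by (induction ns arbitrary: acc) (simp, fastforce)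

lemma refine_mem:
  assumes "n \<in> set ns" "\<And>acc. n' \<in> set (step l n acc)"
  shows "n' \<in> set (refine l ns acc)"
  using assms(1)
proof (induction ns arbitrary: acc)
  case (Cons n'' ns)
  then show ?case using assms(2) refine_acc[of "step l n acc" l ns] by auto
qed simp

lemma stage_mem:
  assumes "n \<in> nodes cs" "\<And>acc. n' \<in> set (step l n acc)"
  shows "n' \<in> nodes (stage l cs)"
  using assms(1)
  by (induction cs) (auto intro: refine_mem[OF _ assms(2)])

text \<open>Because of the sorting not every solution stays in a node of \<open>cs\<close>. One that
  does is enough for a contradiction.\<close>

definition traps :: "int \<Rightarrow> int \<Rightarrow> int list list list \<Rightarrow> bool" where
  "traps N P cs \<longleftrightarrow> (\<exists>m1 m2 m3 t1 t2. large_solution m1 m2 m3 t1 t2) \<longrightarrow>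
    (\<exists>m1 m2 m3 t1 t2. large_solution m1 m2 m3 t1 t2 \<and> node N P m1 m2 m3 t1 t2 \<in> nodes cs)"

lemma traps_stage:
  assumes "traps N P cs" "refines N P N' P' l"
  shows "traps N' P' (stage l cs)"
  unfolding traps_def
proof
  assume "\<exists>m1 m2 m3 t1 t2. large_solution m1 m2 m3 t1 t2"
  then obtain m1 m2 m3 t1 t2 where *: "large_solution m1 m2 m3 t1 t2" "node N P m1 m2 m3 t1 t2 \<in> nodes cs"
    using assms(1) unfolding traps_def by blast
  from step_complete[OF *(1) assms(2) refl] stage_mem[OF *(2)]
  show "\<exists>m1 m2 m3 t1 t2. large_solution m1 m2 m3 t1 t2 \<and> node N' P' m1 m2 m3 t1 t2 \<in> nodes (stage l cs)"
    by blast
qed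

lemma traps_start: "traps 1 1 [[[0, 0, 0, 0, 0]]]"
  by (auto simp: traps_def node_def)

text \<open>The numbers are the factor for \<open>N\<close>, the factor for \<open>P\<close> (absent
  in \<open>Two_Pass\<close>) and the modulus.\<close>

datatype pass = Fib_Pass int int int layout layout | Pow_Pass int int int layout layout | Two_Pass int int layout

fun sieve :: "pass list \<Rightarrow> int \<Rightarrow> int \<Rightarrow> int list list list \<Rightarrow> bool" 
  and sieve_if :: "bool \<Rightarrow> pass list \<Rightarrow> int \<Rightarrow> int \<Rightarrow> int list list list \<Rightarrow> bool" where
  "sieve [] N P [] = True"
| "sieve [] N P (c # cs) = False"
| "sieve (Fib_Pass r q M L L' # ps) N P cs = sieve_if (periodic L Fibonacci M N r \<and> periodic L' Power M P q)
    ps (N * r) (P * q) (stage (Fib_Last M (table L Fibonacci M N r) (table L' Power M P q)) cs)"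
| "sieve (Pow_Pass r q M L L' # ps) N P cs = sieve_if (periodic L Fibonacci M N r \<and> periodic L' Power M P q)
    ps (N * r) (P * q) (stage (Pow_Last M (table L Fibonacci M N r) (table L' Power M P q)) cs)"
| "sieve (Two_Pass r E L # ps) N P cs = sieve_if (periodic L Fibonacci E N r \<and> 2 ^ 13 mod E = 0 \<and> 13 \<le> P)
    ps (N * r) P (stage (Two_Adic E (table L Fibonacci E N r)) cs)"
| "sieve_if True ps N P cs = sieve ps N P cs"
| "sieve_if False ps N P cs = False"

lemma sieve_if_eq: "sieve_if b ps N P cs \<longleftrightarrow> b \<and> sieve ps N P cs"
  by (cases b) simp_all

text \<open>Each pass checks its own periods when it runs, so soundness holds for an arbitrary list
  \<open>ps\<close>, however it was found.\<close>

lemma sieve_sound: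
  assumes "sieve ps N P cs" "traps N P cs"
  shows "\<not> large_solution m1 m2 m3 t1 t2"
proof -
  have "\<not> (\<exists>m1 m2 m3 t1 t2. large_solution m1 m2 m3 t1 t2)"
    using assms
  proof (induction ps arbitrary: N P cs)
    case Nil
    then show ?case by (cases cs) (auto simp: traps_def)
  next
    case (Cons p ps)
    have M: "M > 0" if "periodic L k M N r" for L k M N r using that by (simp add: periodic_def)
    show ?case
    proof (cases p)
      case (Fib_Pass r q M L L')
      let ?l = "Fib_Last M (table L Fibonacci M N r) (table L' Power M P q)"
      have per: "periodic L Fibonacci M N r \<and> periodic L' Power M P q"
        and *: "sieve ps (N * r) (P * q) (stage ?l cs)"
        using Cons.prems(1) unfolding Fib_Pass sieve.simps sieve_if_eq by blast+
      then have "refines N P (N * r) (P * q) ?l" by (auto simp: covers_table intro: M)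
      from Cons.IH[OF * traps_stage[OF Cons.prems(2) this]] show ?thesis .
    next
      case (Pow_Pass r q M L L')
      let ?l = "Pow_Last M (table L Fibonacci M N r) (table L' Power M P q)"
      have per: "periodic L Fibonacci M N r \<and> periodic L' Power M P q"
        and *: "sieve ps (N * r) (P * q) (stage ?l cs)"
        using Cons.prems(1) unfolding Pow_Pass sieve.simps sieve_if_eq by blast+
      then have "refines N P (N * r) (P * q) ?l" by (auto simp: covers_table intro: M)
      from Cons.IH[OF * traps_stage[OF Cons.prems(2) this]] show ?thesis .
    next
      case (Two_Pass r E L)
      let ?l = "Two_Adic E (table L Fibonacci E N r)"
      have per: "periodic L Fibonacci E N r \<and> 2 ^ 13 mod E = 0 \<and> 13 \<le> P"
        and *: "sieve ps (N * r) P (stage ?l cs)"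
        using Cons.prems(1) unfolding Two_Pass sieve.simps sieve_if_eq by blast+
      then have "refines N P (N * r) P ?l" by (auto simp: covers_table intro: M)
      from Cons.IH[OF * traps_stage[OF Cons.prems(2) this]] show ?thesis .
    qed
  qed
  then show ?thesis by blast
qed

section \<open>Running the sieve\<close>

text \<open>Modulo 1 nothing is excluded. This only splits into classes modulo 4: 10 multisets of
  exponents times 20 of indices give 200 chunks of one node each.\<close>

definition root :: "int list list list" where
  "root = singletons (stage (Fib_Last 1 (table Plain Fibonacci 1 1 4) (table Plain Power 1 1 4)) [[[0, 0, 0, 0, 0]]])"

lemma traps_root: "traps 4 4 root"
proof -
  have "periodic Plain Fibonacci 1 1 4" "periodic Plain Power 1 1 4" by code_simp+
  then have "refines 1 1 4 4 (Fib_Last 1 (table Plain Fibonacci 1 1 4) (table Plain Power 1 1 4))"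
    using covers_table by fastforce
  from traps_stage[OF traps_start this] show ?thesis
    unfolding root_def by (simp only: traps_def nodes_singletons)
qed

text \<open>
  Found by a computer search. The odd moduli divide \<open>gcd (fib N) (gcd (fib (N + 1) - 1) (2 ^ P - 1))\<close>,
  where \<open>N\<close> and \<open>P\<close> are the values after the step.
\<close>

definition passes :: "pass list" where
  "passes =
   [Fib_Pass 5 1 5 Plain Plain,
    Pow_Pass 1 5 11 Plain Plain,
    Fib_Pass 2 1 123 Plain Plain,
    Fib_Pass 3 1 31 Plain Plain,
    Two_Pass 1 16 Plain,
    Pow_Pass 1 3 549 Plain Plain,
    Two_Pass 2 32 Plain,
    Fib_Pass 1 1 7 Plain Plain,
    Pow_Pass 1 2 241 Plain Plain,
    Fib_Pass 5 1 3775 Plain Plain,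
    Pow_Pass 1 5 40501 (Cyclic 200 200) Plain,
    Fib_Pass 2 2 1601 Plain Plain,
    Two_Pass 1 64 Plain,
    Fib_Pass 2 1 4801 (Cyclic 4800 2400) (Cyclic 1200 600),
    Two_Pass 1 128 (Cyclic 192 192),
    Fib_Pass 2 1 25601 (Cyclic 3200 1600) (Cyclic 400 200),
    Two_Pass 1 256 (Cyclic 384 384),
    Pow_Pass 1 7 4481 Near Near,
    Fib_Pass 2 1 127 Near Near,
    Two_Pass 1 512 Near,
    Fib_Pass 3 1 30617 Near Near,
    Pow_Pass 1 3 3439 Near Near,
    Fib_Pass 2 1 115201 Near Near,
    Two_Pass 1 1024 Near,
    Pow_Pass 1 4 641 Near Near,
    Pow_Pass 1 2 769 Near Near,
    Pow_Pass 1 2 7681 Near Near,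
    Fib_Pass 2 2 76801 Near Near,
    Two_Pass 1 2048 Near,
    Fib_Pass 2 1 921601 Near Near,
    Two_Pass 1 4096 Near,
    Fib_Pass 2 2 61441 Near Near,
    Two_Pass 1 8192 Near]"

text \<open>The two parts need about the same time and can be run in parallel.\<close>

lemma sieve_first_part: "sieve passes 4 4 (take 120 root)"
  by code_simp

lemma sieve_second_part: "sieve passes 4 4 (drop 120 root)"
  by code_simp

lemma no_large_solution: "\<not> large_solution m1 m2 m3 t1 t2"
proof
  assume "large_solution m1 m2 m3 t1 t2"
  with traps_root obtain n1 n2 n3 s1 s2 where n: "large_solution n1 n2 n3 s1 s2"
    "node 4 4 n1 n2 n3 s1 s2 \<in> nodes root" unfolding traps_def by blast
  have "nodes root = nodes (take 120 root) \<union> nodes (drop 120 root)"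
    by (metis append_take_drop_id nodes_append)
  with n have "traps 4 4 (take 120 root) \<or> traps 4 4 (drop 120 root)"
    unfolding traps_def by blast
  with sieve_sound[OF sieve_first_part] sieve_sound[OF sieve_second_part] n(1) show False by blast
qed


section \<open>Small exponents\<close>

lemma trail_mem:
  assumes "M > 0" "a \<ge> 0" "i \<in> {a..n}"
  shows "(i, pair_at k M i) \<in> set (trail k M [a..n] (pair_at k M a))"
  using assms(2,3)
proof (induction a n rule: upto.induct)
  case (1 a n)
  have "succ_pair k M (pair_at k M a) = pair_at k M (a + 1)"
    using 1(2) by (simp add: pair_at_def succ_pair_residue assms(1) nat_add_distrib)
  then show ?case using 1 by (cases "i = a") (auto simp: upto.simps[of a n])
qed

fun firsts :: "seeds \<Rightarrow> entry" where
  "firsts [] = []"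
| "firsts ((i, x, y) # ps) = (i, x) # firsts ps"

lemma firsts_mem: "(i, p) \<in> set ps \<Longrightarrow> (i, fst p) \<in> set (firsts ps)"
  by (induction ps rule: firsts.induct) auto

text \<open>Three of these numbers add up to at most 3 * 6765 = 20295, two powers up to
  \<open>2 ^ 12\<close> to at most 8192. Hence modulo 32768 congruent sums are equal.\<close>

definition small_fibs :: entry where
  "small_fibs = firsts (trail Fibonacci 32768 [0..20] (pair_at Fibonacci 32768 0))"

text \<open>Both exponents are packed into one number, so that \<open>loop\<close> treats the
  right-hand side as a single item. Base 16 is enough for exponents up to 12.\<close>

definition small_sums :: entry where
  "small_sums = concat (map (\<lambda>t. map (\<lambda>s. (16 * t + s, - (2 ^ nat t + 2 ^ nat s) mod 32768)) [0..t]) [0..12])"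

definition small_hits :: "int list list" where
  "small_hits = loop 32768 0 small_fibs
     [(True, small_fibs), (True, small_fibs), (False, small_sums)] [] []"

lemma small_fibs_mem:
  assumes "m \<le> 20"
  shows "(int m, int (fib m) mod 32768) \<in> set small_fibs"
  using firsts_mem[OF trail_mem[of 32768 0 "int m" 20 Fibonacci]] assms
  by (simp add: small_fibs_def pair_at_def residue_def)

lemma small_hits_mem:
  assumes eq: "fib m1 + fib m2 + fib m3 = 2 ^ t1 + 2 ^ t2"
    and le: "m3 \<le> m2" "m2 \<le> m1" "m1 \<le> 20" "t2 \<le> t1" "t1 \<le> 12"
  shows "[16 * int t1 + int t2, int m1, int m2, int m3] \<in> set small_hits"
proof -
  have sum: "int (fib m1) + int (fib m2) + int (fib m3) = 2 ^ t1 + 2 ^ t2"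
    using arg_cong[OF eq, of int] by simp
  have "(16 * int t1 + int t2, - (2 ^ t1 + 2 ^ t2) mod 32768) \<in> set small_sums"
    using le unfolding small_sums_def by (force intro!: bexI[of _ "int t1"] rev_image_eqI[of "int t2"])
  moreover have "- (2 ^ t1 + 2 ^ t2) mod 32768 = minus_mod 32768 (minus_mod 32768 (minus_mod 32768 0
      (int (fib m3) mod 32768)) (int (fib m2) mod 32768)) (int (fib m1) mod 32768)"
  proof -
    have "- int (fib m3) - int (fib m2) - int (fib m1) = - (2 ^ t1 + 2 ^ t2)" using sum by linarith
    then show ?thesis using minus_mod_eq[of 32768 0 "int (fib m3)"]
      by (simp add: minus_mod_eq del: minus_mod.simps)
  qed
  ultimately have last: "(16 * int t1 + int t2, minus_mod 32768 (minus_mod 32768 (minus_mod 32768 0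
      (int (fib m3) mod 32768)) (int (fib m2) mod 32768)) (int (fib m1) mod 32768)) \<in> set small_sums"
    by (simp only:)
  show ?thesis
    unfolding small_hits_def
    by (rule loop_more[OF small_fibs_mem[of m3]], use le in simp,
        rule loop_more[OF restrict_mem[OF small_fibs_mem[of m2]]], use le in simp, use le in simp,
        rule loop_more[OF restrict_mem[OF small_fibs_mem[of m1]]], use le in simp, use le in simp,
        rule loop_last, rule restrict_mem[OF last], simp)
qed

lemma fib_less_power: "fib n < 2 ^ n"
  by (induction n rule: fib.induct) auto

text \<open>Reduction modulo \<open>2 ^ n\<close> loses nothing by \<open>fib_less_power\<close>, so
  the fast exponentiation gives the exact value.\<close>

lemma fib_code: "int (fib n) = fst (pair_at Fibonacci (2 ^ n) (int n))"
proof -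
  have "int (fib n) < int (2 ^ n)" using fib_less_power[of n] by (simp only: of_nat_less_iff)
  then show ?thesis by (simp add: pair_at_def residue_def mod_pos_pos_trivial)
qed

text \<open>Listed in the order in which \<^const>\<open>loop\<close> produces them.\<close>

definition solutions :: "(nat \<times> nat \<times> nat \<times> nat \<times> nat) list" where
  "solutions =
   [(14, 12, 10, 9, 6), (12, 11, 10, 8, 5), (10, 10, 9, 7, 4), (16, 12, 8, 10, 7),
    (13, 9, 8, 8, 5), (11, 9, 8, 7, 4), (11, 9, 7, 7, 3), (9, 8, 7, 6, 2), (7, 7, 6, 5, 1),
    (12, 6, 6, 7, 5), (6, 6, 6, 4, 3), (16, 9, 5, 10, 1), (13, 9, 5, 8, 4), (11, 9, 5, 6, 6),
    (10, 6, 5, 6, 2), (8, 6, 5, 5, 1), (10, 5, 5, 6, 0), (6, 5, 5, 4, 1), (16, 9, 4, 9, 9),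
    (13, 8, 4, 8, 0), (12, 7, 4, 7, 5), (10, 6, 4, 6, 1), (8, 6, 4, 4, 4), (7, 6, 4, 4, 3),
    (6, 5, 4, 3, 3), (9, 4, 4, 5, 3), (4, 4, 4, 3, 0), (13, 8, 3, 7, 7), (8, 7, 3, 5, 2),
    (10, 6, 3, 6, 0), (6, 6, 3, 4, 1), (14, 5, 3, 8, 7), (11, 5, 3, 6, 5), (7, 5, 3, 4, 2),
    (5, 5, 3, 3, 2), (7, 4, 3, 4, 1), (5, 4, 3, 3, 1), (4, 4, 3, 2, 2), (7, 3, 3, 4, 0),
    (6, 3, 3, 3, 2), (5, 3, 3, 3, 0), (3, 3, 3, 2, 1), (9, 7, 2, 5, 4), (10, 6, 2, 5, 5),
    (6, 6, 2, 4, 0), (9, 5, 2, 5, 3), (7, 4, 2, 4, 0), (6, 4, 2, 3, 2), (5, 4, 2, 3, 0),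
    (8, 3, 2, 4, 3), (7, 3, 2, 3, 3), (5, 3, 2, 2, 2), (4, 3, 2, 2, 1), (3, 3, 2, 2, 0),
    (9, 2, 2, 5, 2), (6, 2, 2, 3, 1), (4, 2, 2, 2, 0), (3, 2, 2, 1, 1), (2, 2, 2, 1, 0),
    (9, 7, 1, 5, 4), (10, 6, 1, 5, 5), (6, 6, 1, 4, 0), (9, 5, 1, 5, 3), (7, 4, 1, 4, 0),
    (6, 4, 1, 3, 2), (5, 4, 1, 3, 0), (8, 3, 1, 4, 3), (7, 3, 1, 3, 3), (5, 3, 1, 2, 2),
    (4, 3, 1, 2, 1), (3, 3, 1, 2, 0), (9, 2, 1, 5, 2), (6, 2, 1, 3, 1), (4, 2, 1, 2, 0),
    (3, 2, 1, 1, 1), (2, 2, 1, 1, 0), (9, 1, 1, 5, 2), (6, 1, 1, 3, 1), (4, 1, 1, 2, 0),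
    (3, 1, 1, 1, 1), (2, 1, 1, 1, 0), (1, 1, 1, 1, 0), (12, 12, 0, 8, 5), (13, 10, 0, 8, 5),
    (11, 10, 0, 7, 4), (9, 9, 0, 6, 2), (10, 7, 0, 6, 2), (8, 7, 0, 5, 1), (6, 6, 0, 3, 3),
    (7, 5, 0, 4, 1), (5, 5, 0, 3, 1), (8, 4, 0, 4, 3), (7, 4, 0, 3, 3), (5, 4, 0, 2, 2),
    (4, 4, 0, 2, 1), (9, 3, 0, 5, 2), (6, 3, 0, 3, 1), (4, 3, 0, 2, 0), (3, 3, 0, 1, 1),
    (6, 2, 0, 3, 0), (5, 2, 0, 2, 1), (4, 2, 0, 1, 1), (3, 2, 0, 1, 0), (2, 2, 0, 0, 0),
    (6, 1, 0, 3, 0), (5, 1, 0, 2, 1), (4, 1, 0, 1, 1), (3, 1, 0, 1, 0), (2, 1, 0, 0, 0),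
    (1, 1, 0, 0, 0), (12, 0, 0, 7, 4), (9, 0, 0, 5, 1), (6, 0, 0, 2, 2), (5, 0, 0, 2, 0),
    (4, 0, 0, 1, 0), (3, 0, 0, 0, 0)]"

fun encode :: "nat \<times> nat \<times> nat \<times> nat \<times> nat \<Rightarrow> int list" where
  "encode (m1, m2, m3, t1, t2) = [16 * int t1 + int t2, int m1, int m2, int m3]"

text \<open>Phrased with \<open>pair_at\<close> for evaluation. The bounds 16 and 10 are included so
  that checking the list also proves them.\<close>

fun is_solution :: "nat \<times> nat \<times> nat \<times> nat \<times> nat \<Rightarrow> bool" where
  "is_solution (m1, m2, m3, t1, t2) \<longleftrightarrow>
    fst (pair_at Fibonacci (2 ^ m1) (int m1)) + fst (pair_at Fibonacci (2 ^ m2) (int m2)) +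
      fst (pair_at Fibonacci (2 ^ m3) (int m3)) = 2 ^ t1 + 2 ^ t2 \<and>
    m1 \<ge> m2 \<and> m2 \<ge> m3 \<and> t1 \<ge> t2 \<and> m1 \<le> 16 \<and> t1 \<le> 10"

lemma is_solution_iff: "is_solution (m1, m2, m3, t1, t2) \<longleftrightarrow>
    fib m1 + fib m2 + fib m3 = 2 ^ t1 + 2 ^ t2 \<and>
    m1 \<ge> m2 \<and> m2 \<ge> m3 \<and> t1 \<ge> t2 \<and> m1 \<le> 16 \<and> t1 \<le> 10"
proof -
  have "fib m1 + fib m2 + fib m3 = 2 ^ t1 + 2 ^ t2 \<longleftrightarrow>
    int (fib m1 + fib m2 + fib m3) = int (2 ^ t1 + 2 ^ t2)"
    by (simp only: of_nat_eq_iff)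
  also have "\<dots> \<longleftrightarrow> int (fib m1) + int (fib m2) + int (fib m3) = 2 ^ t1 + 2 ^ t2" by simp
  finally show ?thesis by (simp only: is_solution.simps fib_code)
qed

lemma solutions_correct: "list_all is_solution solutions"
  by code_simp

lemma solutions_distinct: "distinct solutions"
  by code_simp

lemma solutions_length: "length solutions = 116"
  by code_simp

lemma small_hits_eq: "small_hits = map encode solutions"
  by code_simp

lemma encode_inj:
  assumes "encode (m1, m2, m3, t1, t2) = encode (m1', m2', m3', t1', t2')"
    and "t2 \<le> 12" "t2' \<le> 12"
  shows "(m1, m2, m3, t1, t2) = (m1', m2', m3', t1', t2')"
proof -
  have "(16 * t1 + t2) div 16 = t1" "(16 * t1' + t2') div 16 = t1'" using assms(2,3) by simp_all
  moreover have "16 * t1 + t2 = 16 * t1' + t2'" using assms(1) by simp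
  ultimately have "t1 = t1'" by simp
  then show ?thesis using assms(1) by simp
qed

lemma small_solution:
  assumes "fib m1 + fib m2 + fib m3 = 2 ^ t1 + 2 ^ t2" "m1 \<ge> m2" "m2 \<ge> m3" "t1 \<ge> t2" "t1 \<le> 12"
  shows "(m1, m2, m3, t1, t2) \<in> set solutions"
proof -
  have "m1 \<le> 20"
  proof (rule ccontr)
    assume "\<not> m1 \<le> 20"
    \<comment> \<open>\<open>fib 21 = 10946\<close> already exceeds 8192, the largest possible
      right-hand side.\<close>
    then have "fib 21 \<le> fib m1" by (intro fib_mono) simp
    moreover have "int (fib 21) = 10946" unfolding fib_code by code_simp
    moreover have "(2::nat) ^ t1 \<le> 2 ^ 12" "(2::nat) ^ t2 \<le> 2 ^ 12"
      using assms(4,5) by (intro power_increasing; simp)+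
    ultimately show False using assms(1) by simp
  qed
  then have "encode (m1, m2, m3, t1, t2) \<in> set small_hits"
    using small_hits_mem[OF assms(1,3,2) _ assms(4,5)] by simp
  then have "encode (m1, m2, m3, t1, t2) \<in> encode ` set solutions"
    by (simp only: small_hits_eq set_map)
  then obtain x where x: "x \<in> set solutions" "encode (m1, m2, m3, t1, t2) = encode x" by blast
  obtain n1 n2 n3 s1 s2 where "x = (n1, n2, n3, s1, s2)" by (cases x) auto
  with x have n: "(n1, n2, n3, s1, s2) \<in> set solutions"
    "encode (m1, m2, m3, t1, t2) = encode (n1, n2, n3, s1, s2)" by simp_all
  from n(1) have "is_solution (n1, n2, n3, s1, s2)"
    using solutions_correct unfolding list_all_iff by blast
  then have "s2 \<le> 12" by (simp add: is_solution_iff)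
  with n assms(4,5) encode_inj[OF n(2)] show ?thesis by simp
qed


section \<open>The bounds and the number of solutions\<close>

theorem theorem1p2:
  shows "(\<forall>m1 m2 m3 t1 t2 :: nat.
            fib m1 + fib m2 + fib m3 = 2 ^ t1 + 2 ^ t2 \<and>
            m1 \<ge> m2 \<and> m2 \<ge> m3 \<and> t1 \<ge> t2
            \<longrightarrow> m1 \<le> 16 \<and> t1 \<le> 10)
       \<and> card {(m1::nat, m2::nat, m3::nat, t1::nat, t2::nat).
              fib m1 + fib m2 + fib m3 = 2 ^ t1 + 2 ^ t2 \<and>
              m1 \<ge> m2 \<and> m2 \<ge> m3 \<and> t1 \<ge> t2} = 116"
    (is "?bound \<and> card ?S = 116")
proof -
  have mem: "(m1, m2, m3, t1, t2) \<in> set solutions" if "fib m1 + fib m2 + fib m3 = 2 ^ t1 + 2 ^ t2"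
    "m1 \<ge> m2" "m2 \<ge> m3" "t1 \<ge> t2" for m1 m2 m3 t1 t2
  proof (rule small_solution[OF that])
    show "t1 \<le> 12" using no_large_solution[of m1 m2 m3 t1 t2] that(1) by (simp add: large_solution_def)
  qed
  have sol: "is_solution (m1, m2, m3, t1, t2)" if "(m1, m2, m3, t1, t2) \<in> set solutions" for m1 m2 m3 t1 t2
    using that solutions_correct unfolding list_all_iff by blast
  have eq: "x \<in> ?S \<longleftrightarrow> x \<in> set solutions" for x
  proof -
    obtain m1 m2 m3 t1 t2 where x: "x = (m1, m2, m3, t1, t2)" by (cases x) auto
    show ?thesis
    proof
      assume "x \<in> ?S"
      then show "x \<in> set solutions" unfolding x by (intro mem) simp_all
    next
      assume "x \<in> set solutions"
      then have "is_solution (m1, m2, m3, t1, t2)" unfolding x by (rule sol)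
      then show "x \<in> ?S" unfolding x is_solution_iff by simp
    qed
  qed
  have "?S = set solutions" by (rule set_eqI) (rule eq)
  then have "card ?S = 116"
    using distinct_card[OF solutions_distinct] solutions_length by simp
  moreover have ?bound
    using sol[OF mem] unfolding is_solution_iff by blast
  ultimately show ?thesis by blast
qed

end
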